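(* Let $(M,\omega)$ be a closed symplectic manifold of dimension $2n$. There exists a continuous function $u:M\rightarrow\mathbb{R}$ with $\int_M u\,\omega^n=0$ such that for no finite non-empty collection of volume preserving homeomorphisms $\Phi_1,\ldots,\Phi_k:M\rightarrow M$ (in particular, for no such collection of Hamiltonian homeomorphisms) one has $$\sum_{i=1}^k \Phi_i^*u\equiv 0 .$$
   Context: $\Phi^*u=u\circ\Phi$. "Volume preserving" means preserving the measure on $M$ induced by the volume form $\omega^n$. Hamiltonian homeomorphisms (e.g. homeomorphisms that are uniform limits of sequences of Hamiltonian diffeomorphisms) are volume preserving, so they form a special case. *)

theory Defs
  imports "HOL-Analysis.Analysis"
begin

section \<open>Smooth manifolds\<close>

text \<open>Both notions below are meant for open sets \<open>S\<close> and finite-dimensional domains, where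
  they are the usual classes \<open>C\<^sup>k\<close> and \<open>C\<^sup>\<infinity>\<close>.\<close>

primrec Ck_on :: "nat \<Rightarrow> ('a::real_normed_vector \<Rightarrow> 'b::real_normed_vector) \<Rightarrow> 'a set \<Rightarrow> bool" where
  "Ck_on 0 f S \<longleftrightarrow> continuous_on S f"
| "Ck_on (Suc k) f S \<longleftrightarrow>
     (\<forall>x\<in>S. f differentiable (at x)) \<and> (\<forall>v. Ck_on k (\<lambda>x. frechet_derivative f (at x) v) S)"

definition smooth_on :: "('a::real_normed_vector \<Rightarrow> 'b::real_normed_vector) \<Rightarrow> 'a set \<Rightarrow> bool" where
  "smooth_on f S \<longleftrightarrow> (\<forall>k. Ck_on k f S)"

text \<open>A chart is a pair of its domain \<open>U\<close> and a coordinate map; the values of the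
  coordinate map outside \<open>U\<close> are irrelevant.\<close>

type_synonym ('a, 'e) chart = "'a set \<times> ('a \<Rightarrow> 'e)"

definition is_chart :: "'a topology \<Rightarrow> ('a, 'e::euclidean_space) chart \<Rightarrow> bool" where
  "is_chart X c \<longleftrightarrow> openin X (fst c) \<and> open (snd c ` fst c) \<and>
     homeomorphic_map (subtopology X (fst c)) (top_of_set (snd c ` fst c)) (snd c)"

definition transition :: "('a, 'e::euclidean_space) chart \<Rightarrow> ('a, 'e) chart \<Rightarrow> 'e \<Rightarrow> 'e" where
  "transition c d = snd d \<circ> inv_into (fst c) (snd c)"

text \<open>The atlas is not required to be maximal: any atlas determines a smooth structure.
  Charts onto open subsets of the full Euclidean space mean that there is no boundary.\<close>

definition smooth_manifold :: "'a topology \<Rightarrow> ('a, 'e::euclidean_space) chart set \<Rightarrow> bool" where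
  "smooth_manifold X \<A> \<longleftrightarrow>
     Hausdorff_space X \<and> second_countable X \<and>
     (\<forall>c\<in>\<A>. is_chart X c) \<and> (\<Union>c\<in>\<A>. fst c) = topspace X \<and>
     (\<forall>c\<in>\<A>. \<forall>d\<in>\<A>. smooth_on (transition c d) (snd c ` (fst c \<inter> fst d)))"

section \<open>Symplectic forms\<close>

text \<open>A two-form is given by its local coordinate representations: \<open>\<omega> c x v w\<close> is the value
  of the form, read in the chart \<open>c\<close>, at the point with coordinates \<open>x\<close>, on the tangent vectors
  with coordinates \<open>v\<close> and \<open>w\<close>. The representations of different charts are related by pullback
  along the transition maps.\<close>

type_synonym ('a, 'e) two_form = "('a, 'e) chart \<Rightarrow> 'e \<Rightarrow> 'e \<Rightarrow> 'e \<Rightarrow> real"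

definition smooth_two_form ::
    "('a, 'e::euclidean_space) chart set \<Rightarrow> ('a, 'e) two_form \<Rightarrow> bool" where
  "smooth_two_form \<A> \<omega> \<longleftrightarrow>
     (\<forall>c\<in>\<A>. (\<forall>x \<in> snd c ` fst c. bilinear (\<omega> c x) \<and> (\<forall>v. \<omega> c x v v = 0)) \<and>
             (\<forall>v w. smooth_on (\<lambda>x. \<omega> c x v w) (snd c ` fst c))) \<and>
     (\<forall>c\<in>\<A>. \<forall>d\<in>\<A>. \<forall>x \<in> snd c ` (fst c \<inter> fst d). \<forall>v w.
        \<omega> c x v w =
          \<omega> d (transition c d x) (frechet_derivative (transition c d) (at x) v)
                                 (frechet_derivative (transition c d) (at x) w))"

text \<open>\<open>d\<omega> = 0\<close>, with the exterior derivative evaluated on constant vector fields in coordinates.\<close>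

definition closed_two_form ::
    "('a, 'e::euclidean_space) chart set \<Rightarrow> ('a, 'e) two_form \<Rightarrow> bool" where
  "closed_two_form \<A> \<omega> \<longleftrightarrow>
     (\<forall>c\<in>\<A>. \<forall>x \<in> snd c ` fst c. \<forall>v0 v1 v2.
        frechet_derivative (\<lambda>y. \<omega> c y v1 v2) (at x) v0
        - frechet_derivative (\<lambda>y. \<omega> c y v0 v2) (at x) v1
        + frechet_derivative (\<lambda>y. \<omega> c y v0 v1) (at x) v2 = 0)"

definition nondegenerate_two_form ::
    "('a, 'e::euclidean_space) chart set \<Rightarrow> ('a, 'e) two_form \<Rightarrow> bool" where
  "nondegenerate_two_form \<A> \<omega> \<longleftrightarrow>
     (\<forall>c\<in>\<A>. \<forall>x \<in> snd c ` fst c. \<forall>v. v \<noteq> 0 \<longrightarrow> (\<exists>w. \<omega> c x v w \<noteq> 0))"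

definition symplectic_form ::
    "('a, 'e::euclidean_space) chart set \<Rightarrow> ('a, 'e) two_form \<Rightarrow> bool" where
  "symplectic_form \<A> \<omega> \<longleftrightarrow>
     smooth_two_form \<A> \<omega> \<and> closed_two_form \<A> \<omega> \<and> nondegenerate_two_form \<A> \<omega>"

text \<open>Closed means compact without boundary. Manifolds are nonempty, but connectedness is not
  required. The dimension \<open>2n\<close> is positive because \<open>DIM('e)\<close> is.\<close>

definition closed_symplectic_manifold ::
    "nat \<Rightarrow> 'a topology \<Rightarrow> ('a, 'e::euclidean_space) chart set \<Rightarrow> ('a, 'e) two_form \<Rightarrow> bool" where
  "closed_symplectic_manifold n X \<A> \<omega> \<longleftrightarrow>
     DIM('e) = 2 * n \<and> smooth_manifold X \<A> \<and> compact_space X \<and> topspace X \<noteq> {} \<and>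
     symplectic_form \<A> \<omega>"

section \<open>The measure induced by the volume form\<close>

text \<open>Here an alternating form of degree \<open>p\<close> takes a sequence of vectors and depends only on the
  first \<open>p\<close> of them.\<close>

definition wedge ::
    "nat \<Rightarrow> nat \<Rightarrow> ((nat \<Rightarrow> 'v) \<Rightarrow> real) \<Rightarrow> ((nat \<Rightarrow> 'v) \<Rightarrow> real) \<Rightarrow> (nat \<Rightarrow> 'v) \<Rightarrow> real" where
  "wedge p q \<alpha> \<beta> v =
     (\<Sum>\<sigma> | \<sigma> permutes {..<p + q}.
        of_int (sign \<sigma>) * \<alpha> (\<lambda>i. v (\<sigma> i)) * \<beta> (\<lambda>i. v (\<sigma> (p + i)))) / (fact p * fact q)"

primrec two_form_power :: "('v \<Rightarrow> 'v \<Rightarrow> real) \<Rightarrow> nat \<Rightarrow> (nat \<Rightarrow> 'v) \<Rightarrow> real" where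
  "two_form_power \<beta> 0 = (\<lambda>v. 1)"
| "two_form_power \<beta> (Suc k) = wedge 2 (2 * k) (\<lambda>v. \<beta> (v 0) (v 1)) (two_form_power \<beta> k)"

text \<open>In a chart, \<open>\<omega>\<^sup>n = f dx\<^sub>1 \<and> \<dots> \<and> dx\<^sub>2\<^sub>n\<close>, where \<open>f\<close> is the value of \<open>\<omega>\<^sup>n\<close> on the standard
  basis. The manifold is oriented by \<open>\<omega>\<^sup>n\<close>, so the induced measure has density \<open>\<bar>f\<bar>\<close> with
  respect to Lebesgue measure; the absolute value makes the choice of an enumeration of the
  basis irrelevant.\<close>

definition volume_density ::
    "nat \<Rightarrow> ('a, 'e::euclidean_space) two_form \<Rightarrow> ('a, 'e) chart \<Rightarrow> 'e \<Rightarrow> real" where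
  "volume_density n \<omega> c x = \<bar>two_form_power (\<omega> c x) n (from_nat_into Basis)\<bar>"

text \<open>The measure on the Borel sets of \<open>X\<close> that is concentrated on the domain of the chart \<open>c\<close>
  and agrees there with the measure of \<open>\<omega>\<^sup>n\<close>.\<close>

definition chart_volume ::
    "nat \<Rightarrow> 'a topology \<Rightarrow> ('a, 'e::euclidean_space) two_form \<Rightarrow> ('a, 'e) chart \<Rightarrow> 'a measure" where
  "chart_volume n X \<omega> c =
     distr
       (density (restrict_space lborel (snd c ` fst c)) (\<lambda>x. ennreal (volume_density n \<omega> c x)))
       (sigma (topspace X) {U. openin X U})
       (inv_into (fst c) (snd c))"

text \<open>By the change of variables formula the chart measures agree on overlaps of chart domains.
  Hence their supremum in the lattice of measures is the unique Borel measure which restricts on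
  every chart domain to the measure of \<open>\<omega>\<^sup>n\<close>.\<close>

definition volume_measure ::
    "nat \<Rightarrow> 'a topology \<Rightarrow> ('a, 'e::euclidean_space) chart set \<Rightarrow> ('a, 'e) two_form \<Rightarrow> 'a measure" where
  "volume_measure n X \<A> \<omega> = (SUP c\<in>\<A>. chart_volume n X \<omega> c)"

definition volume_preserving_homeomorphism ::
    "nat \<Rightarrow> 'a topology \<Rightarrow> ('a, 'e::euclidean_space) chart set \<Rightarrow> ('a, 'e) two_form \<Rightarrow>
     ('a \<Rightarrow> 'a) \<Rightarrow> bool" where
  "volume_preserving_homeomorphism n X \<A> \<omega> \<Phi> \<longleftrightarrow>
     homeomorphic_map X X \<Phi> \<and>
     distr (volume_measure n X \<A> \<omega>) (volume_measure n X \<A> \<omega>) \<Phi> = volume_measure n X \<A> \<omega>"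

end

theory Submission
  imports Defs
begin

text \<open>If a continuous \<open>w\<close> takes rational values almost everywhere but has an irrational mean \<open>r\<close>, then
  \<open>u = w - r\<close> works: almost every \<open>x\<close> makes all \<open>w (\<Phi>\<^sub>i x)\<close> rational, so \<open>\<Sum>\<^sub>i u (\<Phi>\<^sub>i x) = 0\<close> would make
  \<open>k r\<close> rational. Take \<open>w = c (g - \<theta>)\<close>, where \<open>c\<close> is the Cantor function, which is rational almost
  everywhere, \<open>g\<close> is a Urysohn function onto \<open>[0, 1]\<close>, and \<open>\<theta> \<in> [0, 1]\<close>. By Fubini, almost every \<open>\<theta>\<close>
  makes \<open>w\<close> rational almost everywhere; and the mean is strictly decreasing in \<open>\<theta>\<close>, hence rational
  for only countably many \<open>\<theta>\<close>.

  The argument needs a finite measure that is positive on nonempty open sets. That the volume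
  measure is such a measure need not be shown: if it is zero or infinite, the
  constant 1 has (Bochner) integral 0, and if a nonempty open set is null, a bump function
  supported in it does; no sum of pullbacks of a nonnegative nonzero function vanishes.\<close>

section \<open>The Cantor function\<close>

text \<open>Iterates of the self-similarity operator whose fixed point is the Cantor function,
  started at the identity clamped to [0, 1]. Being constant outside [0, 1], the iterates satisfy one
  formula on the whole line: the second term is 0 for t \<le> 2/3 and the first is 1 for t \<ge>
  1/3.\<close>

primrec cantor_approx :: "nat \<Rightarrow> real \<Rightarrow> real" where
  "cantor_approx 0 t = max 0 (min 1 t)"
| "cantor_approx (Suc n) t = (cantor_approx n (3 * t) + cantor_approx n (3 * t - 2)) / 2"

definition cantor :: "real \<Rightarrow> real" where
  "cantor t = lim (\<lambda>n. cantor_approx n t)"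

lemma cantor_approx_eq_0: "t \<le> 0 \<Longrightarrow> cantor_approx n t = 0"
  by (induction n arbitrary: t) auto

lemma cantor_approx_eq_1: "t \<ge> 1 \<Longrightarrow> cantor_approx n t = 1"
  by (induction n arbitrary: t) auto

lemma continuous_on_cantor_approx: "continuous_on A (cantor_approx n)"
proof (induction n arbitrary: A)
  case 0
  show ?case by (simp add: continuous_intros)
next
  case (Suc n)
  have "continuous_on A (\<lambda>t. cantor_approx n (3 * t))"
       "continuous_on A (\<lambda>t. cantor_approx n (3 * t - 2))"
    by (rule continuous_on_compose2[OF Suc[of UNIV]]; auto intro!: continuous_intros)+
  then show ?case by (auto intro!: continuous_intros)
qed

lemma mono_cantor_approx: "mono (cantor_approx n)"
proof (induction n)
  case 0
  show ?case by (auto simp: mono_def)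
next
  case (Suc n)
  show ?case
    by (intro monoI) (auto intro!: divide_right_mono add_mono monoD[OF Suc])
qed

text \<open>At every point one of the two terms of the recursion is constant in \<open>n\<close> and
  cancels; the other difference is halved. The split at 1/2 could be made anywhere in
  [1/3, 2/3].\<close>

lemma cantor_approx_diff_le: "\<bar>cantor_approx (Suc n) t - cantor_approx n t\<bar> \<le> (1 / 2) ^ n"
proof (induction n arbitrary: t)
  case 0
  show ?case by (auto simp: max_def min_def abs_if field_simps)
next
  case (Suc n)
  show ?case
  proof (cases "t \<le> 1 / 2")
    case True
    then have "cantor_approx m (3 * t - 2) = 0" for m by (simp add: cantor_approx_eq_0)
    then have eq: "cantor_approx (Suc (Suc n)) t - cantor_approx (Suc n) t
        = (cantor_approx (Suc n) (3 * t) - cantor_approx n (3 * t)) / 2"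
      by (simp only: cantor_approx.simps(2)[of "Suc n" t] cantor_approx.simps(2)[of n t]) argo
    show ?thesis using Suc[of "3 * t"] unfolding eq by (simp del: cantor_approx.simps)
  next
    case False
    then have "cantor_approx m (3 * t) = 1" for m by (simp add: cantor_approx_eq_1)
    then have eq: "cantor_approx (Suc (Suc n)) t - cantor_approx (Suc n) t
        = (cantor_approx (Suc n) (3 * t - 2) - cantor_approx n (3 * t - 2)) / 2"
      by (simp only: cantor_approx.simps(2)[of "Suc n" t] cantor_approx.simps(2)[of n t]) argo
    show ?thesis using Suc[of "3 * t - 2"] unfolding eq by (simp del: cantor_approx.simps)
  qed
qed

text \<open>The geometric bound on successive differences makes their telescoping series converge
  uniformly.\<close>

lemma uniform_limit_cantor_approx:
  "uniform_limit UNIV cantor_approx cantor sequentially"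
proof -
  define h where "h = (\<lambda>t. \<Sum>i. cantor_approx (Suc i) t - cantor_approx i t)"
  have "uniform_limit UNIV (\<lambda>n t. \<Sum>i<n. cantor_approx (Suc i) t - cantor_approx i t) h sequentially"
    unfolding h_def
  proof (rule Weierstrass_m_test)
    show "summable (\<lambda>n. (1 / 2 :: real) ^ n)" by (simp add: summable_geometric)
  qed (use cantor_approx_diff_le in \<open>simp del: cantor_approx.simps\<close>)
  moreover have "(\<Sum>i<n. cantor_approx (Suc i) t - cantor_approx i t)
      = cantor_approx n t - cantor_approx 0 t" for n t
    by (rule sum_lessThan_telescope)
  ultimately have "uniform_limit UNIV (\<lambda>n t. cantor_approx n t - cantor_approx 0 t) h sequentially"
    by (simp del: cantor_approx.simps)
  then have "uniform_limit UNIV (\<lambda>n t. (cantor_approx n t - cantor_approx 0 t) + cantor_approx 0 t)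
      (\<lambda>t. h t + cantor_approx 0 t) sequentially"
    by (intro uniform_limit_add uniform_limit_const)
  then have lim: "uniform_limit UNIV cantor_approx (\<lambda>t. h t + cantor_approx 0 t) sequentially"
    by simp
  moreover have "cantor t = h t + cantor_approx 0 t" for t
    unfolding cantor_def by (rule limI, rule tendsto_uniform_limitI[OF lim]) simp
  ultimately show ?thesis by presburger
qed

section \<open>Basic properties of the limit function\<close>

lemma tendsto_cantor: "(\<lambda>n. cantor_approx n t) \<longlonglongrightarrow> cantor t"
  by (rule tendsto_uniform_limitI[OF uniform_limit_cantor_approx]) simp

lemma continuous_on_cantor: "continuous_on A cantor"
  using uniform_limit_theorem[OF _ uniform_limit_cantor_approx] continuous_on_cantor_approx
  by (auto intro: continuous_on_subset)

lemma mono_cantor: "mono cantor"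
  by (intro monoI LIMSEQ_le[OF tendsto_cantor tendsto_cantor]) (auto intro: monoD[OF mono_cantor_approx])

lemma cantor_eq_0: "t \<le> 0 \<Longrightarrow> cantor t = 0"
  by (simp add: cantor_def cantor_approx_eq_0)

lemma cantor_eq_1: "t \<ge> 1 \<Longrightarrow> cantor t = 1"
  by (simp add: cantor_def cantor_approx_eq_1)

lemma cantor_bounds: "0 \<le> cantor t" "cantor t \<le> 1"
  using monoD[OF mono_cantor, of "min 0 t" t] monoD[OF mono_cantor, of t "max 1 t"]
  by (auto simp: cantor_eq_0 cantor_eq_1)

lemma cantor_self_similar: "cantor t = (cantor (3 * t) + cantor (3 * t - 2)) / 2"
proof (rule LIMSEQ_unique)
  show "(\<lambda>n. cantor_approx (Suc n) t) \<longlonglongrightarrow> cantor t"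
    using tendsto_cantor by (rule LIMSEQ_Suc)
  show "(\<lambda>n. cantor_approx (Suc n) t) \<longlonglongrightarrow> (cantor (3 * t) + cantor (3 * t - 2)) / 2"
    unfolding cantor_approx.simps by (intro tendsto_intros tendsto_cantor) simp
qed

text \<open>Self-similarity gives \<open>cantor t\<close> \<ge> \<open>cantor (3 * t) / 2\<close>,
  and tripling a positive number eventually reaches the region where the value is 1.\<close>

lemma cantor_pos:
  assumes "t > 0"
  shows "cantor t > 0"
proof -
  obtain n where "1 / t < 3 ^ n" using real_arch_pow[of 3 "1 / t"] by auto
  then have "3 ^ n * t \<ge> 1" using assms by (simp add: field_simps)
  then show ?thesis
  proof (induction n arbitrary: t)
    case 0
    then show ?case by (simp add: cantor_eq_1)
  next
    case (Suc n)
    then have "cantor (3 * t) > 0" by (simp add: mult_ac)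
    then show ?case
      using cantor_self_similar[of t] cantor_bounds(1)[of "3 * t - 2"] by simp
  qed
qed

section \<open>Rationality of the Cantor function almost everywhere\<close>

lemma cantor_irrational_rescale:
  assumes "cantor t \<notin> \<rat>"
  shows "cantor (3 * t) \<notin> \<rat> \<or> cantor (3 * t - 2) \<notin> \<rat>"
  using assms cantor_self_similar[of t] by auto

lemma borel_measurable_cantor [measurable]: "cantor \<in> borel_measurable borel"
  by (intro borel_measurable_continuous_onI continuous_on_cantor)

text \<open>By self-similarity the exceptional set \<open>N\<close> is covered by two copies of
  itself shrunk by the factor 3. Hence its measure is at most 2/3 of itself, and being finite it is
  0.\<close>

lemma AE_cantor_rational: "AE t in lborel. cantor t \<in> \<rat>"
proof -
  define N where "N = {t. cantor t \<notin> \<rat>}"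
  have Q: "(\<rat> :: real set) \<in> sets borel"
    using countable_rat by (rule sets.countable[rotated]) simp
  have N [measurable]: "N \<in> sets borel"
  proof -
    have "N = cantor -` (- \<rat>) \<inter> space borel" by (auto simp: N_def)
    also have "\<dots> \<in> sets borel"
      using Q by (intro measurable_sets[OF borel_measurable_cantor]) (rule borel_comp)
    finally show ?thesis .
  qed
  have sub: "N \<subseteq> {0..1}"
  proof
    fix t assume "t \<in> N"
    then show "t \<in> {0..1}"
      using cantor_eq_0[of t] cantor_eq_1[of t] by (cases "t \<le> 0"; cases "t \<ge> 1") (auto simp: N_def)
  qed
  have fin: "emeasure lborel N < \<infinity>"
    using emeasure_mono[OF sub, of lborel] by (simp add: order.strict_trans1)
  let ?f = "indicator N :: real \<Rightarrow> real"
  have int: "integrable lborel ?f" using fin by (simp add: integrable_indicator_iff)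
  have scaled: "integrable lborel (\<lambda>t. ?f (3 * t - d))"
    "(\<integral>t. ?f (3 * t - d) \<partial>lborel) = measure lborel N / 3" for d
    using lborel_integrable_real_affine[OF int, of 3 "- d"]
      lborel_integral_real_affine[of 3 ?f "- d"] by simp_all
  have "measure lborel N = (\<integral>t. ?f t \<partial>lborel)" by simp
  also have "\<dots> \<le> (\<integral>t. ?f (3 * t - 0) + ?f (3 * t - 2) \<partial>lborel)"
  proof (rule integral_mono)
    show "integrable lborel (\<lambda>t. ?f (3 * t - 0) + ?f (3 * t - 2))"
      by (intro Bochner_Integration.integrable_add scaled(1))
    show "?f t \<le> ?f (3 * t - 0) + ?f (3 * t - 2)" for t
      using cantor_irrational_rescale[of t] by (auto simp: N_def indicator_def)
  qed (rule int)
  also have "\<dots> = 2 * (measure lborel N / 3)"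
    using Bochner_Integration.integral_add[OF scaled(1) scaled(1), of 0 2] scaled(2)[of 0] scaled(2)[of 2]
    by linarith
  finally have "measure lborel N = 0"
    using measure_nonneg[of lborel N] by linarith
  \<comment> \<open>Finiteness matters again: \<open>measure\<close> is also 0 on sets of infinite
    \<open>emeasure\<close>.\<close>
  then have "N \<in> null_sets lborel"
    using fin by (auto simp: emeasure_eq_ennreal_measure null_setsI)
  then show ?thesis
    by (rule AE_I') (auto simp: N_def)
qed

section \<open>Borel measures on a compact Hausdorff space\<close>

lemma space_eq_topspace:
  assumes "sets M = sigma_sets (topspace X) {U. openin X U}"
  shows "space M = topspace X"
proof -
  have "sets M = sets (sigma (topspace X) {U. openin X U})"
    using assms openin_subset by (subst sets_measure_of) auto
  from sets_eq_imp_space_eq[OF this] show ?thesis by (simp add: space_measure_of_conv)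
qed

lemma continuous_map_measurable:
  assumes "sets M = sigma_sets (topspace X) {U. openin X U}"
    and "sets N = sigma_sets (topspace Y) {U. openin Y U}"
    and "continuous_map X Y f"
  shows "f \<in> measurable M N"
proof (rule measurable_sigma_sets)
  show "{U. openin Y U} \<subseteq> Pow (topspace Y)" using openin_subset by auto
  show "f \<in> space M \<rightarrow> topspace Y"
    using assms(3) space_eq_topspace[OF assms(1)] by (auto simp: continuous_map_def)
  fix U assume "U \<in> {U. openin Y U}"
  then have "openin X {x \<in> topspace X. f x \<in> U}"
    using openin_continuous_map_preimage[OF assms(3)] by simp
  moreover have "f -` U \<inter> space M = {x \<in> topspace X. f x \<in> U}"
    using space_eq_topspace[OF assms(1)] by auto
  ultimately show "f -` U \<inter> space M \<in> sets M" using assms(1) by auto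
qed (rule assms(2))

lemma continuous_map_borel_measurable:
  assumes "sets M = sigma_sets (topspace X) {U. openin X U}"
    and "continuous_map X euclideanreal f"
  shows "f \<in> borel_measurable M"
proof (rule continuous_map_measurable[OF assms(1) _ assms(2)])
  show "sets (borel :: real measure) = sigma_sets (topspace euclideanreal) {U. openin euclideanreal U}"
    by (simp add: sets_borel)
qed

lemma Urysohn_point:
  assumes "compact_space X" "Hausdorff_space X" "closedin X C" "p \<in> topspace X" "p \<notin> C"
  obtains f where "continuous_map X (top_of_set {0..1 :: real}) f" "f p = 1" "\<And>x. x \<in> C \<Longrightarrow> f x = 0"
proof -
  have "normal_space X"
    using assms(1,2) compact_Hausdorff_or_regular_imp_normal_space by blast
  moreover have "closedin X {p}"
    using assms(2,4) by (rule closedin_Hausdorff_singleton)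
  ultimately obtain f where "continuous_map X (top_of_set {0..1 :: real}) f" "f ` C \<subseteq> {0}" "f ` {p} \<subseteq> {1}"
    using Urysohn_lemma[of X C "{p}" 0 1] assms(3,5) by (auto simp: disjnt_def)
  then show thesis by (intro that[of f]) auto
qed

text \<open>Stated for an arbitrary measure, so that the main argument sees only a compact Hausdorff
  space with a Borel measure.\<close>

definition no_vanishing_sum :: "'a topology \<Rightarrow> 'a measure \<Rightarrow> ('a \<Rightarrow> real) \<Rightarrow> bool" where
  "no_vanishing_sum X M u \<longleftrightarrow>
     \<not> (\<exists>(k::nat) (\<Phi> :: nat \<Rightarrow> 'a \<Rightarrow> 'a). k \<ge> 1 \<and>
          (\<forall>i\<in>{1..k}. homeomorphic_map X X (\<Phi> i) \<and> distr M M (\<Phi> i) = M) \<and>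
          (\<forall>x\<in>topspace X. (\<Sum>i=1..k. (u \<circ> \<Phi> i) x) = 0))"

text \<open>By surjectivity some \<open>x\<close> is sent to \<open>p\<close> by the first map; at
  \<open>x\<close> the sum is at least \<open>u p\<close>.\<close>

lemma no_vanishing_sum_nonneg:
  assumes nonneg: "\<And>x. x \<in> topspace X \<Longrightarrow> 0 \<le> u x"
    and pos: "p \<in> topspace X" "u p > 0"
  shows "no_vanishing_sum X M u"
  unfolding no_vanishing_sum_def
proof clarify
  fix k :: nat and \<Phi> :: "nat \<Rightarrow> 'a \<Rightarrow> 'a"
  assume k: "1 \<le> k" and \<Phi>: "\<forall>i\<in>{1..k}. homeomorphic_map X X (\<Phi> i) \<and> distr M M (\<Phi> i) = M"
    and sum: "\<forall>x\<in>topspace X. (\<Sum>i=1..k. (u \<circ> \<Phi> i) x) = 0"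
  have surj: "\<Phi> i ` topspace X = topspace X" if "i \<in> {1..k}" for i
    using \<Phi> that homeomorphic_imp_surjective_map by blast
  then obtain x where x: "x \<in> topspace X" "\<Phi> 1 x = p"
    using pos(1) k by (metis atLeastAtMost_iff imageE order_refl)
  have "u (\<Phi> i x) \<ge> 0" if "i \<in> {1..k}" for i
    using surj[OF that] x(1) nonneg by blast
  then have "(u \<circ> \<Phi> 1) x \<le> (\<Sum>i=1..k. (u \<circ> \<Phi> i) x)"
    using k by (intro member_le_sum) auto
  then show False using sum x pos(2) by simp
qed

lemma no_vanishing_sum_irrational_shift:
  assumes sM: "sets M = sigma_sets (topspace X) {U. openin X U}"
    and w: "continuous_map X euclideanreal w"
    and rat: "AE x in M. w x \<in> \<rat>"
    and r: "r \<notin> \<rat>"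
    and M: "emeasure M (space M) \<noteq> 0"
  shows "no_vanishing_sum X M (\<lambda>x. w x - r)"
  unfolding no_vanishing_sum_def
proof clarify
  fix k :: nat and \<Phi> :: "nat \<Rightarrow> 'a \<Rightarrow> 'a"
  assume k: "1 \<le> k" and \<Phi>: "\<forall>i\<in>{1..k}. homeomorphic_map X X (\<Phi> i) \<and> distr M M (\<Phi> i) = M"
    and sum: "\<forall>x\<in>topspace X. (\<Sum>i=1..k. ((\<lambda>x. w x - r) \<circ> \<Phi> i) x) = 0"
  have [measurable]: "w \<in> borel_measurable M"
    by (rule continuous_map_borel_measurable[OF sM w])
  have [measurable]: "(\<rat> :: real set) \<in> sets borel"
    using countable_rat by (rule sets.countable[rotated]) simp
  have "AE x in M. w (\<Phi> i x) \<in> \<rat>" if i: "i \<in> {1..k}" for i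
  proof -
    have "\<Phi> i \<in> measurable M M"
      using \<Phi> i by (intro continuous_map_measurable[OF sM sM] homeomorphic_imp_continuous_map) auto
    moreover have "{x \<in> space M. w x \<in> \<rat>} \<in> sets M" by measurable
    moreover have "distr M M (\<Phi> i) = M" using \<Phi> i by blast
    \<comment> \<open>Invariance of \<open>M\<close> carries the almost everywhere statement from
      \<open>w\<close> over to its pullback.\<close>
    then have "AE x in distr M M (\<Phi> i). w x \<in> \<rat>" using rat by (rule ssubst)
    ultimately show ?thesis by (simp only: AE_distr_iff)
  qed
  then have ae: "AE x in M. \<forall>i\<in>{1..k}. w (\<Phi> i x) \<in> \<rat>"
    by (intro AE_finite_allI) auto
  have "\<exists>x\<in>space M. \<forall>i\<in>{1..k}. w (\<Phi> i x) \<in> \<rat>"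
  proof (rule ccontr)
    assume "\<not> ?thesis"
    then have "AE x in M. False" using ae by (auto elim: AE_mp)
    then show False using M by (simp add: AE_iff_measurable[OF sets.top])
  qed
  then obtain x where x: "x \<in> topspace X" "\<And>i. i \<in> {1..k} \<Longrightarrow> w (\<Phi> i x) \<in> \<rat>"
    using space_eq_topspace[OF sM] by auto
  have "(\<Sum>i=1..k. w (\<Phi> i x)) = real k * r"
    using sum x(1) by (simp add: sum_subtractf)
  then have "r = (\<Sum>i=1..k. w (\<Phi> i x)) / real k" using k by simp
  moreover have "(\<Sum>i=1..k. w (\<Phi> i x)) \<in> \<rat>" 
    using x(2) by (intro Rats_sum) auto
  ultimately show False using r by simp
qed

text \<open>The connected set \<open>S\<close> with two distinct points guarantees a continuous
  function that attains every value in [0, 1].\<close>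

lemma exists_no_vanishing_sum:
  assumes X: "compact_space X" "Hausdorff_space X"
    and S: "connectedin X S" "a \<in> S" "b \<in> S" "a \<noteq> b"
    and sM: "sets M = sigma_sets (topspace X) {U. openin X U}"
  shows "\<exists>u. continuous_map X euclideanreal u \<and> (LINT x|M. u x) = 0 \<and> no_vanishing_sum X M u"
proof -
  have spM: "space M = topspace X" by (rule space_eq_topspace[OF sM])
  have ab: "a \<in> topspace X" "b \<in> topspace X" using S connectedin_subset_topspace by blast+
  \<comment> \<open>Since \<open>measure\<close> turns infinite mass into 0, failure of the first
    case yields finite total mass.\<close>
  consider (degenerate) "measure M (space M) = 0"
    | (null_open) U p where "openin X U" "p \<in> U" "emeasure M U = 0"
    | (regular) "emeasure M (space M) \<noteq> \<infinity>" "\<And>U p. openin X U \<Longrightarrow> p \<in> U \<Longrightarrow> emeasure M U \<noteq> 0"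
    by (metis enn2real_top infinity_ennreal_def measure_def)
  then show ?thesis
  proof cases
    case degenerate
    \<comment> \<open>This includes infinite total mass, where the integral of a constant is 0 by convention.\<close>
    then have "(LINT x|M. (1::real)) = 0" by simp
    moreover have "no_vanishing_sum X M (\<lambda>_. 1)"
      using ab(1) by (rule no_vanishing_sum_nonneg[rotated]) auto
    ultimately show ?thesis by (intro exI[of _ "\<lambda>_. 1"]) auto
  next
    case (null_open U p)
    have p: "p \<in> topspace X" using null_open openin_subset by blast
    obtain f where f: "continuous_map X (top_of_set {0..1 :: real}) f" "f p = 1"
      "\<And>x. x \<in> topspace X - U \<Longrightarrow> f x = 0"
      using Urysohn_point[OF X, of "topspace X - U" p] null_open p by blast
    have cf: "continuous_map X euclideanreal f" "\<And>x. x \<in> topspace X \<Longrightarrow> 0 \<le> f x"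
      using f(1) by (auto simp: continuous_map_in_subtopology)
    have "U \<in> null_sets M" using null_open sM by (intro null_setsI) auto
    then have "AE x in M. f x = 0"
      by (rule AE_I') (use f(3) spM in auto)
    then have "(LINT x|M. f x) = 0" by (rule integral_eq_zero_AE)
    moreover have "no_vanishing_sum X M f"
      using cf(2) p f(2) by (intro no_vanishing_sum_nonneg) auto
    ultimately show ?thesis using cf(1) by blast
  next
    case regular
    interpret finite_measure M by (rule finite_measureI) (rule regular(1))
    have total: "measure M (space M) > 0"
      using regular(2)[OF openin_topspace ab(1)] spM by (simp add: zero_less_measure_iff emeasure_eq_measure)
    obtain g where g: "continuous_map X (top_of_set {0..1 :: real}) g" "g b = 1" "g a = 0"
      using Urysohn_point[OF X closedin_Hausdorff_singleton[OF X(2) ab(1)] ab(2)] S(4) by auto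
    have cg: "continuous_map X euclideanreal g" using g(1) by (simp add: continuous_map_in_subtopology)
    then have [measurable]: "g \<in> borel_measurable M" by (rule continuous_map_borel_measurable[OF sM])
    have "connected (g ` S)"
      using connectedin_continuous_map_image[OF cg S(1)] by simp
    \<comment> \<open>Intermediate values along \<open>S\<close>, from \<open>g a = 0\<close> to
      \<open>g b = 1\<close>.\<close>
    then have onto: "\<exists>x\<in>topspace X. g x = t" if "0 \<le> t" "t \<le> 1" for t
      using connectedD_interval[of "g ` S" 0 1 t] that S(2,3) g(2,3) connectedin_subset_topspace[OF S(1)]
      by (metis imageE imageI subsetD)

    define w where "w = (\<lambda>\<theta> x. cantor (g x - \<theta>))"
    define m where "m = (\<lambda>\<theta>. (LINT x|M. w \<theta> x))"
    have cw: "continuous_map X euclideanreal (w \<theta>)" for \<theta>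
    proof -
      have "continuous_map X euclideanreal (cantor \<circ> (\<lambda>x. g x - \<theta>))"
        by (rule continuous_map_compose[of _ euclideanreal])
          (use cg continuous_on_cantor in \<open>auto intro!: continuous_intros\<close>)
      then show ?thesis by (simp add: w_def comp_def)
    qed
    have [measurable]: "w \<theta> \<in> borel_measurable M" for \<theta>
      by (rule continuous_map_borel_measurable[OF sM cw])
    have int: "integrable M (w \<theta>)" for \<theta>
      by (rule integrable_const_bound[of _ 1]) (use cantor_bounds in \<open>auto simp: w_def\<close>)

    \<comment> \<open>At a point with \<open>g x0 = \<theta>'\<close> the two integrands are
      \<open>cantor (\<theta>' - \<theta>)\<close>, which is positive, and \<open>cantor 0\<close>,
      which is 0. By continuity the nonnegative difference stays positive on an open set, which has
      nonzero measure.\<close>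
    have decr: "m \<theta>' < m \<theta>" if "\<theta> < \<theta>'" "0 \<le> \<theta>" "\<theta>' \<le> 1" for \<theta> \<theta>'
    proof -
      let ?f = "\<lambda>x. w \<theta> x - w \<theta>' x"
      have nonneg: "?f x \<ge> 0" for x
        using monoD[OF mono_cantor, of "g x - \<theta>'" "g x - \<theta>"] that by (simp add: w_def)
      have "0 \<le> \<theta>'" using that by simp
      then obtain x0 where x0: "x0 \<in> topspace X" "g x0 = \<theta>'" using onto \<open>\<theta>' \<le> 1\<close> by blast
      have "?f x0 > 0"
        using that cantor_pos[of "\<theta>' - \<theta>"] cantor_eq_0[of 0] by (simp add: w_def x0)
      define U where "U = {x \<in> topspace X. ?f x \<in> {0<..}}"
      have "openin X U"
        unfolding U_def
        by (rule openin_continuous_map_preimage[of _ euclideanreal]) (auto intro!: continuous_intros cw)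
      moreover have "x0 \<in> U" using x0 \<open>?f x0 > 0\<close> by (simp add: U_def)
      ultimately have "emeasure M U \<noteq> 0" "U \<in> sets M" using regular(2) sM by auto
      have intf: "integrable M ?f" using int by auto
      have "(LINT x|M. ?f x) \<noteq> 0"
      proof
        assume "(LINT x|M. ?f x) = 0"
        then have "AE x in M. ?f x = 0"
          using integral_nonneg_eq_0_iff_AE[OF intf] nonneg by simp
        then have "emeasure M U = 0"
          by (subst (asm) AE_iff_measurable[OF \<open>U \<in> sets M\<close>]) (use nonneg spM in \<open>force simp: U_def less_le\<close>)+
        then show False using \<open>emeasure M U \<noteq> 0\<close> by simp
      qed
      moreover have "(LINT x|M. ?f x) \<ge> 0" using nonneg by (intro integral_nonneg_AE) simp
      moreover have "(LINT x|M. ?f x) = m \<theta> - m \<theta>'" using int by (simp add: m_def)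
      ultimately show ?thesis by simp
    qed

    have [measurable]: "(\<rat> :: real set) \<in> sets borel"
      using countable_rat by (rule sets.countable[rotated]) simp
    interpret P: pair_sigma_finite M lborel
      by (intro pair_sigma_finite.intro sigma_finite_measure_axioms sigma_finite_lborel)
    \<comment> \<open>For fixed \<open>x\<close> the map \<theta> to \<open>g x - \<theta>\<close>
      is affine with slope -1, so preimages of null sets are null. Fubini then exchanges the two
      quantifiers.\<close>
    have "AE \<theta> in lborel. cantor (g x + (- 1) * \<theta>) \<in> \<rat>" for x
      by (rule AE_borel_affine[OF _ _ AE_cantor_rational]) auto
    then have "AE x in M. AE \<theta> in lborel. w \<theta> x \<in> \<rat>"
      by (simp add: w_def)
    then have ae: "AE \<theta> in lborel. AE x in M. w \<theta> x \<in> \<rat>"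
      unfolding w_def by (subst (asm) P.AE_commute) measurable

    define bad where "bad = {\<theta> \<in> {0..1}. m \<theta> / measure M (space M) \<in> \<rat>}"
    \<comment> \<open>Strict monotonicity, available on [0, 1], embeds \<open>bad\<close> into the
      rationals.\<close>
    have "inj_on (\<lambda>\<theta>. m \<theta> / measure M (space M)) bad"
      using decr total by (intro linorder_inj_onI) (fastforce simp: bad_def)+
    moreover have "countable ((\<lambda>\<theta>. m \<theta> / measure M (space M)) ` bad)"
      by (rule countable_subset[OF _ countable_rat]) (auto simp: bad_def)
    ultimately have "countable bad" by (rule countable_image_inj_on[rotated])
    then have "AE \<theta> in lborel. \<theta> \<notin> bad"
      by (intro AE_not_in countable_imp_null_set_lborel)
    with ae have "AE \<theta> in lborel. \<theta> \<notin> bad \<and> (AE x in M. w \<theta> x \<in> \<rat>)" by eventually_elim auto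
    \<comment> \<open>The interval has positive length, so almost every parameter being good
      provides a good one inside it.\<close>
    moreover have "\<not> (AE \<theta> in lborel. \<theta> \<notin> {0..1 :: real})"
      by (subst AE_iff_measurable[of "{0..1}"]) auto
    ultimately obtain \<theta> where \<theta>: "\<theta> \<in> {0..1}" "\<theta> \<notin> bad" "AE x in M. w \<theta> x \<in> \<rat>"
      by (metis (mono_tags, lifting) AE_mp AE_I2)
    define r where "r = m \<theta> / measure M (space M)"
    have "r \<notin> \<rat>" using \<theta> by (simp add: bad_def r_def)
    then have "no_vanishing_sum X M (\<lambda>x. w \<theta> x - r)"
      using total \<theta>(3) by (intro no_vanishing_sum_irrational_shift[OF sM cw]) (auto simp: measure_def)
    moreover have "(LINT x|M. w \<theta> x - r) = 0"
      using int[of \<theta>] total by (simp add: r_def m_def)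
    moreover have "continuous_map X euclideanreal (\<lambda>x. w \<theta> x - r)"
      by (intro continuous_intros cw)
    ultimately show ?thesis by blast
  qed
qed

section \<open>Symplectic manifolds\<close>

text \<open>All chart measures live on the same Borel sets. An empty atlas is excluded because the
  supremum of no measures is the bottom measure, whose space is empty.\<close>

lemma sets_volume_measure:
  assumes "\<A> \<noteq> {}"
  shows "sets (volume_measure n X \<A> \<omega>) = sigma_sets (topspace X) {U. openin X U}"
proof -
  have "sets (sigma (topspace X) {U. openin X U}) = sigma_sets (topspace X) {U. openin X U}"
    using openin_subset by (intro sets_measure_of) auto
  moreover have "sets (volume_measure n X \<A> \<omega>) = sets (sigma (topspace X) {U. openin X U})"
    unfolding volume_measure_def by (rule sets_SUP) (simp_all add: chart_volume_def assms)
  ultimately show ?thesis by simp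
qed

text \<open>Take the preimage of a small coordinate ball around the image of \<open>p\<close>: it is
  connected, as balls are. The second point \<open>b\<close> lies half a radius away in a basis
  direction, which exists since the dimension is positive.\<close>

lemma chart_connected_pair:
  fixes c :: "('a, 'e::euclidean_space) chart"
  assumes c: "is_chart X c" and p: "p \<in> fst c"
  obtains S a b where "connectedin X S" "a \<in> S" "b \<in> S" "a \<noteq> b"
proof -
  let ?U = "fst c" and ?V = "snd c ` fst c"
  have hom: "homeomorphic_map (subtopology X ?U) (top_of_set ?V) (snd c)" and "openin X ?U" "open ?V"
    using c by (auto simp: is_chart_def)
  obtain e where e: "e > 0" "ball (snd c p) e \<subseteq> ?V"
    using \<open>open ?V\<close> p open_contains_ball by blast
  have top: "topspace (subtopology X ?U) = ?U"
    using openin_subset[OF \<open>openin X ?U\<close>] by auto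
  define S where "S = {x \<in> ?U. snd c x \<in> ball (snd c p) e}"
  have img: "snd c ` S = ball (snd c p) e" using e by (auto simp: S_def)
  have "connectedin (subtopology X ?U) S"
    unfolding homeomorphic_map_connectedness_eq[OF hom] top img
    using e(2) by (auto simp: S_def connectedin_subtopology)
  then have "connectedin X S" by (simp add: connectedin_subtopology)
  moreover obtain v :: 'e where v: "v \<in> Basis" using nonempty_Basis by blast
  have "snd c p + (e / 2) *\<^sub>R v \<in> ball (snd c p) e" using e(1) v by (simp add: dist_norm)
  then obtain b where "b \<in> S" "snd c b = snd c p + (e / 2) *\<^sub>R v" using img by (metis imageE)
  moreover have "b \<noteq> p" using calculation e(1) v by auto
  moreover have "p \<in> S" using p e(1) by (simp add: S_def)
  ultimately show thesis using that by blast
qed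

theorem proposition1p3:
  fixes n :: nat
    and X :: "'a topology"
    and \<A> :: "('a, 'e::euclidean_space) chart set"
    and \<omega> :: "('a, 'e) two_form"
  assumes "closed_symplectic_manifold n X \<A> \<omega>"
  shows "\<exists>u :: 'a \<Rightarrow> real.
           continuous_map X euclideanreal u \<and>
           (LINT x | volume_measure n X \<A> \<omega>. u x) = 0 \<and>
           \<not> (\<exists>(k::nat) (\<Phi> :: nat \<Rightarrow> 'a \<Rightarrow> 'a).
                k \<ge> 1 \<and>
                (\<forall>i\<in>{1..k}. volume_preserving_homeomorphism n X \<A> \<omega> (\<Phi> i)) \<and>
                (\<forall>x\<in>topspace X. (\<Sum>i=1..k. (u \<circ> \<Phi> i) x) = 0))"
proof -
  have X: "compact_space X" "Hausdorff_space X" "topspace X \<noteq> {}"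
    and charts: "\<forall>c\<in>\<A>. is_chart X c" "(\<Union>c\<in>\<A>. fst c) = topspace X"
    using assms by (auto simp: closed_symplectic_manifold_def smooth_manifold_def)
  \<comment> \<open>A point of the nonempty space supplies a chart, which gives both the connected
    set and nonemptiness of the atlas.\<close>
  then obtain c p where "c \<in> \<A>" "p \<in> fst c" by blast
  then obtain S a b where "connectedin X S" "a \<in> S" "b \<in> S" "a \<noteq> b"
    using chart_connected_pair charts(1) by metis
  moreover have "sets (volume_measure n X \<A> \<omega>) = sigma_sets (topspace X) {U. openin X U}"
    using \<open>c \<in> \<A>\<close> by (intro sets_volume_measure) auto
  ultimately show ?thesis
    using exists_no_vanishing_sum[OF X(1,2)]
    unfolding no_vanishing_sum_def volume_preserving_homeomorphism_def by blast
qed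

end
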